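(* Let $Q\subseteq\mathbb{R}^N$ be convex, let $\boldsymbol{\beta}=(\beta_1,\dots,\beta_n)\in(\mathbb{R}_{\ge 0})^n$ be a vector of body radii, and let $\mathbf{p}=(p_1,\dots,p_n)\in Q^n$ be a configuration with $p_i\neq p_j$ for all $i\ne j$. Let $\mathcal{B}(\mathbf{p},\boldsymbol{\beta})=\{B_1,\dots,B_n\}$ be the body diagram of $Q$ associated with $\mathbf{p}$ and $\boldsymbol{\beta}$. Then $\mathbf{p}$ is collision free if and only if every robot body is contained in the interior of its body cell, i.e. $$\mathbf{p}\in\mathrm{Conf}(Q,\boldsymbol{\beta})\iff D(p_i,\beta_i)\subset\mathring{B}_i\quad\text{for all } i\in\{1,\dots,n\}.$$
   Context: $\|\cdot\|$ is the Euclidean norm, $\mathring{A}$ is the interior of $A$ in $\mathbb{R}^N$, and $D(x,r)=\{y\in\mathbb{R}^N : \|x-y\|\le r\}$ is the closed disk of radius $r\ge 0$ centered at $x$. The body diagram of $Q$ associated with $\mathbf{p}$ and $\boldsymbol{\beta}$ is the power diagram $\mathcal{B}(\mathbf{p},\boldsymbol{\beta})=\{B_1,\dots,B_n\}$ with cells $$B_i=\{q\in Q : \|q-p_i\|^2-\beta_i^2\le\|q-p_j\|^2-\beta_j^2\ \ \forall j\ne i\}.$$ The configuration space of non-colliding disks is $$\mathrm{Conf}(Q,\boldsymbol{\beta})=\{\mathbf{p}\in Q^n : \|p_i-p_j\|>\beta_i+\beta_j\ \ \forall i\ne j,\ \ D(p_i,\beta_i)\subset\mathring{Q}\ \ \forall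 i\}.$$ *)

theory Defs
  imports "HOL-Analysis.Analysis"
begin

text \<open>
  Ambient space and number of bodies are type-indexed: \<open>real ^ 'N\<close> is $\mathbb{R}^N$ with its
  Euclidean norm, and a configuration \<open>p\<close> of the bodies indexed by \<open>'n\<close> is an element of
  \<open>(real ^ 'N) ^ 'n\<close>. The disk $D(x,r)$ is \<open>cball x r\<close>.
\<close>

text \<open>The body diagram as an indexed family: \<open>body_diagram Q p \<beta> i\<close> is the cell $B_i$.\<close>

definition body_diagram ::
  "(real ^ 'N) set \<Rightarrow> (real ^ 'N) ^ 'n \<Rightarrow> real ^ 'n \<Rightarrow> 'n \<Rightarrow> (real ^ 'N) set" where
  "body_diagram Q p \<beta> i =
     {q \<in> Q. \<forall>j. j \<noteq> i \<longrightarrow>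
        (norm (q - p $ i))\<^sup>2 - (\<beta> $ i)\<^sup>2 \<le> (norm (q - p $ j))\<^sup>2 - (\<beta> $ j)\<^sup>2}"

definition Conf :: "(real ^ 'N) set \<Rightarrow> real ^ 'n \<Rightarrow> ((real ^ 'N) ^ 'n) set" where
  "Conf Q \<beta> =
     {p. (\<forall>i. p $ i \<in> Q) \<and>
         (\<forall>i j. i \<noteq> j \<longrightarrow> norm (p $ i - p $ j) > \<beta> $ i + \<beta> $ j) \<and>
         (\<forall>i. cball (p $ i) (\<beta> $ i) \<subseteq> interior Q)}"

end

(* The difference of the powers of a point with respect to two bodies with distinct centers is a
   nonconstant affine function, so two cells meet only in a hyperplane and their interiors are
   disjoint; hence so are the disks, which forces their centers apart. Conversely, the power with
   respect to a body is nonpositive exactly on its disk, so on a disk disjoint from all others the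
   strict power inequalities hold, and they define an open subset of the cell. *)

theory Submission
  imports Defs
begin

lemma interior_body_diagram_disjoint:
  assumes "i \<noteq> j" "p $ i \<noteq> p $ j"
  shows "interior (body_diagram Q p \<beta> i) \<inter> interior (body_diagram Q p \<beta> j) = {}"
proof -
  \<comment> \<open>Equating the two powers at \<open>x\<close> cancels the square of
    \<open>norm x\<close>; what remains is linear in \<open>x\<close>, with normal
    \<open>2 *\<^sub>R (p $ i - p $ j)\<close> and this constant.\<close>
  let ?c = "(norm (p $ i))\<^sup>2 - (\<beta> $ i)\<^sup>2 - (norm (p $ j))\<^sup>2 + (\<beta> $ j)\<^sup>2"
  have "body_diagram Q p \<beta> i \<inter> body_diagram Q p \<beta> j \<subseteq> {x. (2 *\<^sub>R (p $ i - p $ j)) \<bullet> x = ?c}"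
  proof
    fix x assume "x \<in> body_diagram Q p \<beta> i \<inter> body_diagram Q p \<beta> j"
    then have
      "(norm (x - p $ i))\<^sup>2 - (\<beta> $ i)\<^sup>2 \<le> (norm (x - p $ j))\<^sup>2 - (\<beta> $ j)\<^sup>2"
      "(norm (x - p $ j))\<^sup>2 - (\<beta> $ j)\<^sup>2 \<le> (norm (x - p $ i))\<^sup>2 - (\<beta> $ i)\<^sup>2"
      using assms(1) by (simp_all add: body_diagram_def)
    then have
      "(norm (x - p $ i))\<^sup>2 - (\<beta> $ i)\<^sup>2 = (norm (x - p $ j))\<^sup>2 - (\<beta> $ j)\<^sup>2"
      by (rule antisym)
    then show "x \<in> {x. (2 *\<^sub>R (p $ i - p $ j)) \<bullet> x = ?c}"
      by (simp add: power2_norm_eq_inner inner_diff_left inner_diff_right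
          inner_commute[of x "p $ i"] inner_commute[of x "p $ j"])
  qed
  \<comment> \<open>Distinct centers make the normal nonzero, so the hyperplane has empty
    interior.\<close>
  from interior_mono[OF this] have
    "interior (body_diagram Q p \<beta> i \<inter> body_diagram Q p \<beta> j) = {}"
    using interior_hyperplane[of "2 *\<^sub>R (p $ i - p $ j)" ?c] assms(2) by auto
  then show ?thesis
    by (simp only: interior_Int)
qed

text \<open>The point dividing the segment from \<open>x\<close> to \<open>y\<close> in the ratio
  \<open>r : s\<close> lies in both balls. Its contrapositive turns disjointness of disks into a
  bound on the distance of their centers.\<close>

lemma cball_Int_cball_nonempty:
  fixes x y :: "'a::real_normed_vector"
  assumes "0 \<le> r" "0 \<le> s" "dist x y \<le> r + s"
  shows "cball x r \<inter> cball y s \<noteq> {}"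
\<comment> \<open>The ratio is undefined when both radii vanish; then the centers coincide.\<close>
proof (cases "r + s = 0")
  case True
  with assms have "r = 0" "s = 0" "x = y" by auto
  then show ?thesis by simp
next
  case False
  with assms have pos: "r + s > 0" by simp
  define z where "z = x + (r / (r + s)) *\<^sub>R (y - x)"
  have "dist x z = (r / (r + s)) * dist x y"
    using assms pos by (simp add: z_def dist_norm norm_minus_commute)
  also have "\<dots> \<le> (r / (r + s)) * (r + s)"
    using assms pos by (intro mult_left_mono) auto
  finally have r: "dist x z \<le> r" using pos by simp
  have "y - z = (1 - r / (r + s)) *\<^sub>R (y - x)"
    by (simp add: z_def algebra_simps)
  also have "1 - r / (r + s) = s / (r + s)"
    using pos by (simp add: field_simps)
  finally have "dist y z = (s / (r + s)) * dist x y"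
    using assms pos by (simp add: dist_norm norm_minus_commute)
  also have "\<dots> \<le> (s / (r + s)) * (r + s)"
    using assms pos by (intro mult_left_mono) auto
  finally have "dist y z \<le> s" using pos by simp
  with r show ?thesis by auto
qed

lemma Conf_imp_cball_subset_interior:
  fixes p :: "(real ^ 'N) ^ 'n"
  assumes p: "p \<in> Conf Q \<beta>" and nonneg: "\<And>i. \<beta> $ i \<ge> 0"
  shows "cball (p $ i) (\<beta> $ i) \<subseteq> interior (body_diagram Q p \<beta> i)"
proof (rule subset_trans[OF _ interior_maximal])
  let ?pow = "\<lambda>j q. (norm (q - p $ j))\<^sup>2 - (\<beta> $ j)\<^sup>2"
  \<comment> \<open>Strict inequalities make each set open, and finiteness of the index type keeps
    the intersection open.\<close>
  let ?U = "interior Q \<inter> (\<Inter>j\<in>-{i}. {q. ?pow i q < ?pow j q})"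
  show "?U \<subseteq> body_diagram Q p \<beta> i"
    unfolding body_diagram_def using interior_subset by (blast intro: less_imp_le)
  show "open ?U"
    by (intro open_Int open_interior open_INT finite open_Collect_less ballI continuous_intros)
  show "cball (p $ i) (\<beta> $ i) \<subseteq> ?U"
  proof
    fix q assume q: "q \<in> cball (p $ i) (\<beta> $ i)"
    \<comment> \<open>By the triangle inequality \<open>q\<close> lies outside the disk of
      \<open>j\<close>, so its power is at most 0 for \<open>i\<close> and positive for
      \<open>j\<close>.\<close>
    have "?pow i q < ?pow j q" if "j \<noteq> i" for j
    proof -
      have qi: "norm (q - p $ i) \<le> \<beta> $ i"
        using q by (simp add: dist_norm norm_minus_commute)
      have "\<beta> $ i + \<beta> $ j < norm (p $ i - p $ j)"
        using p that by (auto simp: Conf_def)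
      also have "\<dots> \<le> norm (q - p $ i) + norm (q - p $ j)"
        by (metis dist_norm dist_triangle3)
      finally have "\<beta> $ j < norm (q - p $ j)"
        using qi by simp
      then have "(\<beta> $ j)\<^sup>2 < (norm (q - p $ j))\<^sup>2"
        using nonneg[of j] by (intro power_strict_mono) auto
      moreover have "(norm (q - p $ i))\<^sup>2 \<le> (\<beta> $ i)\<^sup>2"
        using qi by (intro power_mono) auto
      ultimately show ?thesis by simp
    qed
    moreover have "q \<in> interior Q"
      using p q unfolding Conf_def by blast
    ultimately show "q \<in> ?U" by auto
  qed
qed

theorem proposition2:
  fixes Q :: "(real ^ 'N) set"
    and \<beta> :: "real ^ 'n"
    and p :: "(real ^ 'N) ^ 'n"
  assumes "convex Q"
    and "\<And>i. \<beta> $ i \<ge> 0"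
    and "\<And>i. p $ i \<in> Q"
    and "\<And>i j. i \<noteq> j \<Longrightarrow> p $ i \<noteq> p $ j"
  shows "p \<in> Conf Q \<beta> \<longleftrightarrow> (\<forall>i. cball (p $ i) (\<beta> $ i) \<subseteq> interior (body_diagram Q p \<beta> i))"
proof
  assume "p \<in> Conf Q \<beta>"
  then show "\<forall>i. cball (p $ i) (\<beta> $ i) \<subseteq> interior (body_diagram Q p \<beta> i)"
    using Conf_imp_cball_subset_interior assms(2) by blast
next
  assume sub: "\<forall>i. cball (p $ i) (\<beta> $ i) \<subseteq> interior (body_diagram Q p \<beta> i)"
  have "\<beta> $ i + \<beta> $ j < norm (p $ i - p $ j)" if "i \<noteq> j" for i j
  proof (rule ccontr)
    \<comment> \<open>Disks this close share a point, which would lie in the interiors of two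
      different cells.\<close>
    assume "\<not> \<beta> $ i + \<beta> $ j < norm (p $ i - p $ j)"
    then have "cball (p $ i) (\<beta> $ i) \<inter> cball (p $ j) (\<beta> $ j) \<noteq> {}"
      using assms(2) by (intro cball_Int_cball_nonempty) (auto simp: dist_norm)
    with sub interior_body_diagram_disjoint[OF that assms(4)[OF that]] show False
      by blast
  qed
  moreover have "body_diagram Q p \<beta> i \<subseteq> Q" for i
    by (auto simp: body_diagram_def)
  then have "cball (p $ i) (\<beta> $ i) \<subseteq> interior Q" for i
    using sub interior_mono by blast
  ultimately show "p \<in> Conf Q \<beta>"
    using assms(3) by (simp add: Conf_def)
qed

end
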